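(* Let $k\ge2$ be an integer. Then $\mathrm{Fix}(\mathcal{G}_k)=S_1\cup S_2\cup S_3\cup S_4\cup S_5\cup S_6$, where $S_1=\{\varPhi_{G_2}(\tfrac{d}{k-1},\tfrac{e}{k-1}):d,e\in\mathbf{Z}\}$, $S_2=\{\varPhi_{G_2}(\tfrac{d}{k^2-1},\tfrac{dk}{k^2-1}):d\in\mathbf{Z}\}$, $S_3=\{\varPhi_{G_2}(\tfrac{d}{k^2+k+1},\tfrac{dk}{k^2+k+1}):d\in\mathbf{Z}\}$, $S_4=\{\varPhi_{G_2}(\tfrac{d}{k+1},\tfrac{e}{k+1}):d,e\in\mathbf{Z}\}$, $S_5=\{\varPhi_{G_2}(\tfrac{d}{k^2-1},\tfrac{-dk}{k^2-1}):d\in\mathbf{Z}\}$, $S_6=\{\varPhi_{G_2}(\tfrac{d}{k^2-k+1},\tfrac{-dk}{k^2-k+1}):d\in\mathbf{Z}\}$.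
   Context: Define $\varPhi_{G_2}=(\varphi_1,\varphi_2):\mathbf{C}^2\to\mathbf{C}^2$ by $\varphi_1(\sigma,\tau)=e^{2\pi i\sigma}+e^{2\pi i\tau}+e^{2\pi i(\sigma+\tau)}+e^{-2\pi i\sigma}+e^{-2\pi i\tau}+e^{-2\pi i(\sigma+\tau)}$ and $\varphi_2(\sigma,\tau)=e^{2\pi i(2\sigma+\tau)}+e^{2\pi i(\sigma+2\tau)}+e^{2\pi i(\sigma-\tau)}+e^{-2\pi i(2\sigma+\tau)}+e^{-2\pi i(\sigma+2\tau)}+e^{-2\pi i(\sigma-\tau)}$. For each integer $k\ge0$, $\mathcal{G}_k:\mathbf{C}^2\to\mathbf{C}^2$ is the unique polynomial map (with integer coefficients) such that $\varPhi_{G_2}(k\sigma,k\tau)=\mathcal{G}_k(\varPhi_{G_2}(\sigma,\tau))$ for all $\sigma,\tau\in\mathbf{C}$. $\mathrm{Fix}(f)=\{\alpha\in\mathbf{C}^2:f(\alpha)=\alpha\}$. *)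

theory Defs
  imports Complex_Main
begin

definition ex :: "complex \<Rightarrow> complex" where
  "ex z = exp (2 * of_real pi * \<i> * z)"

definition phi1 :: "complex \<Rightarrow> complex \<Rightarrow> complex" where
  "phi1 \<sigma> \<tau> = ex \<sigma> + ex \<tau> + ex (\<sigma> + \<tau>) + ex (- \<sigma>) + ex (- \<tau>) + ex (- (\<sigma> + \<tau>))"

definition phi2 :: "complex \<Rightarrow> complex \<Rightarrow> complex" where
  "phi2 \<sigma> \<tau> = ex (2 * \<sigma> + \<tau>) + ex (\<sigma> + 2 * \<tau>) + ex (\<sigma> - \<tau>)
     + ex (- (2 * \<sigma> + \<tau>)) + ex (- (\<sigma> + 2 * \<tau>)) + ex (- (\<sigma> - \<tau>))"

definition Phi_G2 :: "complex \<times> complex \<Rightarrow> complex \<times> complex" where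
  "Phi_G2 = (\<lambda>(\<sigma>, \<tau>). (phi1 \<sigma> \<tau>, phi2 \<sigma> \<tau>))"

definition int_poly_fun2 :: "(complex \<times> complex \<Rightarrow> complex) \<Rightarrow> bool" where
  "int_poly_fun2 f \<longleftrightarrow> (\<exists>(n::nat) (c :: nat \<Rightarrow> nat \<Rightarrow> int). \<forall>x y.
     f (x, y) = (\<Sum>i\<le>n. \<Sum>j\<le>n. of_int (c i j) * x ^ i * y ^ j))"

definition int_poly_map2 :: "(complex \<times> complex \<Rightarrow> complex \<times> complex) \<Rightarrow> bool" where
  "int_poly_map2 F \<longleftrightarrow> int_poly_fun2 (\<lambda>p. fst (F p)) \<and> int_poly_fun2 (\<lambda>p. snd (F p))"

text \<open>
  The description below determines a map: existence holds because the power sums of the six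
  exponentials occurring in \<open>phi1\<close> (resp. \<open>phi2\<close>) satisfy a linear recurrence whose coefficients
  are integer polynomials in \<open>phi1\<close> and \<open>phi2\<close>; uniqueness holds because \<open>Phi_G2\<close> is surjective.
\<close>

definition G2_map :: "nat \<Rightarrow> complex \<times> complex \<Rightarrow> complex \<times> complex" where
  "G2_map k = (THE G. int_poly_map2 G \<and>
     (\<forall>\<sigma> \<tau>. Phi_G2 (of_nat k * \<sigma>, of_nat k * \<tau>) = G (Phi_G2 (\<sigma>, \<tau>))))"

definition Fix :: "(complex \<times> complex \<Rightarrow> complex \<times> complex) \<Rightarrow> (complex \<times> complex) set" where
  "Fix f = {\<alpha>. f \<alpha> = \<alpha>}"

end

theory Submission
  imports Defs
    "HOL-Analysis.Complex_Transcendental"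
    "HOL-Computational_Algebra.Fundamental_Theorem_Algebra"
begin

text \<open>
  Put \<open>a = ex \<sigma>\<close>, \<open>b = ex \<tau>\<close>, \<open>c = ex (- (\<sigma> + \<tau>))\<close>, so that \<open>a * b * c = 1\<close>, and let \<open>e\<^sub>1\<close>, \<open>e\<^sub>2\<close> be the
  first two elementary symmetric functions of \<open>a, b, c\<close>; thus \<open>e\<^sub>2\<close> is the sum of the inverses.
  Then \<open>phi1 = e\<^sub>1 + e\<^sub>2\<close> and \<open>phi2 = e\<^sub>1 * e\<^sub>2 - 3\<close>. Hence \<open>Phi_G2\<close> is surjective, and two points have the
  same image iff their triples agree up to a permutation and a simultaneous inversion. A fixed
  point is therefore the image of some \<open>(\<sigma>, \<tau>)\<close> for which multiplication by \<open>k\<close> or by \<open>- k\<close> permutes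
  \<open>\<sigma>, \<tau>, - (\<sigma> + \<tau>)\<close> modulo the integers: the identity, transpositions and 3-cycles yield three families
  for each of the two signs.
\<close>

section \<open>Integer polynomial functions in two variables\<close>

lemma int_poly_fun2_const: "int_poly_fun2 (\<lambda>p. of_int a)"
  unfolding int_poly_fun2_def by (intro exI[of _ 0] exI[of _ "\<lambda>_ _. a"]) simp

text \<open>Zero padding brings two functions with different degree bounds to a common bound, so
  that their coefficients can be added.\<close>

lemma int_poly_fun2_pad:
  assumes "n \<le> N"
  shows "(\<Sum>i\<le>n. \<Sum>j\<le>n. of_int (c i j) * x ^ i * y ^ j :: complex) =
    (\<Sum>i\<le>N. \<Sum>j\<le>N. of_int (if i \<le> n \<and> j \<le> n then c i j else 0) * x ^ i * y ^ j)"
proof -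
  have "(\<Sum>i\<le>N. \<Sum>j\<le>N. of_int (if i \<le> n \<and> j \<le> n then c i j else 0) * x ^ i * y ^ j :: complex)
     = (\<Sum>i\<le>n. \<Sum>j\<le>N. of_int (if i \<le> n \<and> j \<le> n then c i j else 0) * x ^ i * y ^ j)"
    using assms by (intro sum.mono_neutral_right) auto
  also have "\<dots> = (\<Sum>i\<le>n. \<Sum>j\<le>n. of_int (if i \<le> n \<and> j \<le> n then c i j else 0) * x ^ i * y ^ j)"
    using assms by (intro sum.cong sum.mono_neutral_right) auto
  also have "\<dots> = (\<Sum>i\<le>n. \<Sum>j\<le>n. of_int (c i j) * x ^ i * y ^ j)"
    by (intro sum.cong) auto
  finally show ?thesis by simp
qed

lemma int_poly_fun2_add:
  assumes "int_poly_fun2 f" "int_poly_fun2 g"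
  shows "int_poly_fun2 (\<lambda>p. f p + g p)"
proof -
  obtain n c where f: "\<And>x y. f (x, y) = (\<Sum>i\<le>n. \<Sum>j\<le>n. of_int (c i j) * x ^ i * y ^ j)"
    using assms(1) unfolding int_poly_fun2_def by blast
  obtain m d where g: "\<And>x y. g (x, y) = (\<Sum>i\<le>m. \<Sum>j\<le>m. of_int (d i j) * x ^ i * y ^ j)"
    using assms(2) unfolding int_poly_fun2_def by blast
  show ?thesis
    unfolding int_poly_fun2_def f g
    by (rule exI[of _ "max n m"], subst int_poly_fun2_pad[of n "max n m"], simp,
        subst int_poly_fun2_pad[of m "max n m"], simp,
        rule exI[of _ "\<lambda>i j. (if i \<le> n \<and> j \<le> n then c i j else 0) + (if i \<le> m \<and> j \<le> m then d i j else 0)"])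
       (simp only: of_int_add distrib_right sum.distrib simp_thms)
qed

lemma int_poly_fun2_cmult:
  assumes "int_poly_fun2 f"
  shows "int_poly_fun2 (\<lambda>p. of_int a * f p)"
proof -
  obtain n c where f: "\<And>x y. f (x, y) = (\<Sum>i\<le>n. \<Sum>j\<le>n. of_int (c i j) * x ^ i * y ^ j)"
    using assms unfolding int_poly_fun2_def by blast
  show ?thesis
    unfolding int_poly_fun2_def f
    by (intro exI[of _ n] exI[of _ "\<lambda>i j. a * c i j"]) (simp add: sum_distrib_left mult.assoc)
qed

lemma int_poly_fun2_mult_fst:
  assumes "int_poly_fun2 f"
  shows "int_poly_fun2 (\<lambda>p. fst p * f p)"
proof -
  obtain n c where f: "\<And>x y. f (x, y) = (\<Sum>i\<le>n. \<Sum>j\<le>n. of_int (c i j) * x ^ i * y ^ j)"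
    using assms unfolding int_poly_fun2_def by blast
  show ?thesis
    unfolding int_poly_fun2_def f
    \<comment> \<open>Multiplication by \<open>x\<close> shifts the first index by one. The bound
      grows to \<open>Suc n\<close> in both indices, hence the zeros at \<open>i = 0\<close> and in
      the new column \<open>j > n\<close>.\<close>
    by (intro exI[of _ "Suc n"] exI[of _ "\<lambda>i j. if i = 0 \<or> j > n then 0 else c (i - 1) j"] allI,
        subst sum.atMost_Suc_shift)
       (simp add: sum_distrib_left mult_ac)
qed

lemma int_poly_fun2_mult_snd:
  assumes "int_poly_fun2 f"
  shows "int_poly_fun2 (\<lambda>p. snd p * f p)"
proof -
  obtain n c where f: "\<And>x y. f (x, y) = (\<Sum>i\<le>n. \<Sum>j\<le>n. of_int (c i j) * x ^ i * y ^ j)"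
    using assms unfolding int_poly_fun2_def by blast
  let ?d = "\<lambda>i j. if j = 0 \<or> i > n then 0 else c i (j - 1)"
  have "y * f (x, y) = (\<Sum>i\<le>Suc n. \<Sum>j\<le>Suc n. of_int (?d i j) * x ^ i * y ^ j)" for x y
  proof -
    have "(\<Sum>i\<le>Suc n. \<Sum>j\<le>Suc n. of_int (?d i j) * x ^ i * y ^ j) =
        (\<Sum>i\<le>n. \<Sum>j\<le>Suc n. of_int (?d i j) * x ^ i * y ^ j)"
      by (subst sum.atMost_Suc) simp
    also have "\<dots> = (\<Sum>i\<le>n. \<Sum>j\<le>n. of_int (c i j) * x ^ i * y ^ Suc j)"
      by (rule sum.cong[OF refl], subst sum.atMost_Suc_shift) simp
    also have "\<dots> = y * f (x, y)"
      by (simp add: f sum_distrib_left mult_ac)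
    finally show ?thesis by simp
  qed
  then show ?thesis
    unfolding int_poly_fun2_def fst_conv snd_conv by (intro exI[of _ "Suc n"] exI[of _ ?d]) simp
qed

lemma int_poly_fun2_sum:
  assumes "finite A" "\<And>i. i \<in> A \<Longrightarrow> int_poly_fun2 (f i)"
  shows "int_poly_fun2 (\<lambda>p. \<Sum>i\<in>A. f i p)"
  using assms
  by (induction A rule: finite_induct)
     (simp_all add: int_poly_fun2_add int_poly_fun2_const[of 0, simplified])

text \<open>Expanding only \<open>f\<close> into monomials reduces the product to repeated
  multiplication of \<open>g\<close> by coordinates, integer multiples and finite sums.\<close>

lemma int_poly_fun2_mult:
  assumes "int_poly_fun2 f" "int_poly_fun2 g"
  shows "int_poly_fun2 (\<lambda>p. f p * g p)"
proof -
  obtain n c where f: "\<And>x y. f (x, y) = (\<Sum>i\<le>n. \<Sum>j\<le>n. of_int (c i j) * x ^ i * y ^ j)"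
    using assms(1) unfolding int_poly_fun2_def by blast
  have fst_pow: "int_poly_fun2 (\<lambda>p. fst p ^ i * h p)" if "int_poly_fun2 h" for i h
    using that by (induction i) (simp_all add: mult.assoc int_poly_fun2_mult_fst)
  have snd_pow: "int_poly_fun2 (\<lambda>p. snd p ^ i * h p)" if "int_poly_fun2 h" for i h
    using that by (induction i) (simp_all add: mult.assoc int_poly_fun2_mult_snd)
  have "(\<lambda>p. f p * g p) =
      (\<lambda>p. \<Sum>i\<le>n. \<Sum>j\<le>n. of_int (c i j) * (fst p ^ i * (snd p ^ j * g p)))"
    by (auto simp: f sum_distrib_right mult.assoc)
  moreover have "int_poly_fun2 \<dots>"
    by (intro int_poly_fun2_sum int_poly_fun2_cmult fst_pow snd_pow assms(2)) auto
  ultimately show ?thesis by simp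
qed

lemma int_poly_fun2_diff:
  assumes "int_poly_fun2 f" "int_poly_fun2 g"
  shows "int_poly_fun2 (\<lambda>p. f p - g p)"
  using int_poly_fun2_add[OF assms(1) int_poly_fun2_cmult[OF assms(2), of "-1"]] by simp

lemma int_poly_fun2_fst: "int_poly_fun2 fst"
  using int_poly_fun2_mult_fst[OF int_poly_fun2_const[of 1]] by simp

lemma int_poly_fun2_snd: "int_poly_fun2 snd"
  using int_poly_fun2_mult_snd[OF int_poly_fun2_const[of 1]] by simp

lemmas int_poly_fun2_intros =
  int_poly_fun2_add int_poly_fun2_diff int_poly_fun2_mult int_poly_fun2_fst int_poly_fun2_snd
  int_poly_fun2_const int_poly_fun2_const[of 0, simplified] int_poly_fun2_const[of 1, simplified]
  int_poly_fun2_const[of 3, simplified]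

section \<open>The exponentials and the elementary symmetric functions\<close>

lemma ex_nonzero [simp]: "ex z \<noteq> 0"
  by (simp add: ex_def)

lemma ex_add: "ex (z + w) = ex z * ex w"
  by (simp add: ex_def distrib_left exp_add)

lemma ex_minus: "ex (- z) = inverse (ex z)"
  by (simp add: ex_def exp_minus)

lemma ex_diff: "ex (z - w) = ex z / ex w"
  by (simp add: ex_def right_diff_distrib exp_diff)

lemmas ex_hom = ex_add ex_minus ex_diff

lemma ex_of_nat_mult: "ex (of_nat k * z) = ex z ^ k"
  by (simp add: ex_def exp_of_nat_mult[symmetric] mult_ac)

lemma ex_eq_iff: "ex z = ex w \<longleftrightarrow> (\<exists>n::int. z = w + of_int n)"
proof -
  have "ex z = ex w \<longleftrightarrow> (\<exists>n::int. 2 * of_real pi * \<i> * z = 2 * of_real pi * \<i> * (w + of_int n))"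
    unfolding ex_def exp_eq by (simp add: algebra_simps)
  then show ?thesis by simp
qed

lemma ex_surj:
  assumes "a \<noteq> 0"
  shows "\<exists>z. ex z = a"
  using assms by (intro exI[of _ "Ln a / (2 * of_real pi * \<i>)"]) (simp add: ex_def)

text \<open>This is \<open>e\<^sub>1\<close>. Since the three exponentials have product 1, negating
  both arguments yields \<open>e\<^sub>2\<close>.\<close>

definition triple_sum :: "complex \<Rightarrow> complex \<Rightarrow> complex" where
  "triple_sum \<sigma> \<tau> = ex \<sigma> + ex \<tau> + ex (- (\<sigma> + \<tau>))"

lemma phi1_eq: "phi1 \<sigma> \<tau> = triple_sum \<sigma> \<tau> + triple_sum (- \<sigma>) (- \<tau>)"
  by (simp add: phi1_def triple_sum_def ex_hom)

text \<open>Of the nine products in \<open>e\<^sub>1 * e\<^sub>2\<close>, three equal 1 and the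
  other six are the quotients of distinct members of the triple, which are the terms of
  \<open>phi2\<close>.\<close>

lemma phi2_eq: "phi2 \<sigma> \<tau> = triple_sum \<sigma> \<tau> * triple_sum (- \<sigma>) (- \<tau>) - 3"
  unfolding phi2_def triple_sum_def mult_2 ex_hom by (simp add: field_simps)

lemma Phi_G2_eq:
  "Phi_G2 (\<sigma>, \<tau>) = (triple_sum \<sigma> \<tau> + triple_sum (- \<sigma>) (- \<tau>),
     triple_sum \<sigma> \<tau> * triple_sum (- \<sigma>) (- \<tau>) - 3)"
  by (simp add: Phi_G2_def phi1_eq phi2_eq)

section \<open>Surjectivity of \<open>Phi_G2\<close>\<close>

lemma complex_sum_prod_surj: "\<exists>u v :: complex. u + v = s \<and> u * v = m"
proof (intro exI conjI)
  let ?r = "csqrt (s\<^sup>2 - 4 * m)"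
  show "(s + ?r) / 2 + (s - ?r) / 2 = s" by (simp add: field_simps)
  have "(s + ?r) * (s - ?r) = 4 * m"
    by (simp add: algebra_simps power2_eq_square[symmetric])
  then show "(s + ?r) / 2 * ((s - ?r) / 2) = m" by simp
qed

text \<open>Both pairs are the roots of one monic quadratic.\<close>

lemma sum_prod_eq_iff:
  fixes u v :: "'a :: idom"
  shows "u + v = u' + v' \<and> u * v = u' * v' \<longleftrightarrow> u = u' \<and> v = v' \<or> u = v' \<and> v = u'"
proof
  assume *: "u + v = u' + v' \<and> u * v = u' * v'"
  then have v: "v = u' + v' - u" by (simp add: algebra_simps)
  have "(u - u') * (u - v') = 0" using * unfolding v by (simp add: algebra_simps)
  then show "u = u' \<and> v = v' \<or> u = v' \<and> v = u'" using v by auto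
qed auto

text \<open>The three exponentials are found as the roots of \<open>X^3 - u X^2 + v X - 1\<close>.
  The constant term makes them nonzero with product 1, so logarithms exist and the third is
  determined by the other two.\<close>

lemma triple_sum_surj: "\<exists>\<sigma> \<tau>. triple_sum \<sigma> \<tau> = u \<and> triple_sum (- \<sigma>) (- \<tau>) = v"
proof -
  have "\<exists>a. poly [:-1, v, -u, 1:] a = 0"
    by (rule fundamental_theorem_of_algebra_alt) auto
  then obtain a where a: "a ^ 3 - u * a\<^sup>2 + v * a - 1 = 0"
    by (auto simp: algebra_simps power2_eq_square power3_eq_cube)
  then have a0: "a \<noteq> 0" by auto
  \<comment> \<open>The remaining two roots, from their sum and product.\<close>
  obtain b c where bc: "b + c = u - a" "b * c = inverse a"
    using complex_sum_prod_surj by blast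
  then have bc0: "b \<noteq> 0" "c \<noteq> 0" using a0 by auto
  obtain \<sigma> \<tau> where st: "ex \<sigma> = a" "ex \<tau> = b" using ex_surj a0 bc0 by metis
  have c: "c = inverse (a * b)" using bc(2) a0 bc0 by (simp add: field_simps)
  have "triple_sum \<sigma> \<tau> = u"
    using bc(1) by (simp add: triple_sum_def ex_hom st c field_simps)
  moreover have "triple_sum (- \<sigma>) (- \<tau>) = v"
  proof -
    have "a * b * c = 1" using bc(2) a0 by (simp add: mult.assoc)
    then have "triple_sum (- \<sigma>) (- \<tau>) = b * c + a * c + a * b"
      using a0 bc0 by (simp add: triple_sum_def ex_hom st field_simps)
    also have "\<dots> = inverse a + a * (u - a)" using bc by (simp add: algebra_simps flip: bc(1))
    also have "\<dots> = v" using a a0 by (simp add: field_simps power2_eq_square power3_eq_cube)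
    finally show ?thesis .
  qed
  ultimately show ?thesis by blast
qed

lemma surj_Phi_G2: "surj Phi_G2"
  unfolding surj_def
proof
  fix p :: "complex \<times> complex"
  obtain u v where uv: "u + v = fst p" "u * v = snd p + 3" using complex_sum_prod_surj by blast
  obtain \<sigma> \<tau> where "triple_sum \<sigma> \<tau> = u" "triple_sum (- \<sigma>) (- \<tau>) = v" using triple_sum_surj by blast
  then have "p = Phi_G2 (\<sigma>, \<tau>)" using uv by (simp add: Phi_G2_eq prod_eq_iff)
  then show "\<exists>x. p = Phi_G2 x" by blast
qed

section \<open>Existence and uniqueness of the polynomial maps\<close>

text \<open>Newton's recurrence: \<open>a\<close>, \<open>b\<close> and \<open>c\<close> are roots
  of a cubic with constant term -1.\<close>

lemma power_sum_recurrence: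
  fixes a b c :: "'a :: comm_ring_1"
  assumes "a * b * c = 1"
  shows "a ^ (k + 3) + b ^ (k + 3) + c ^ (k + 3) =
    (a + b + c) * (a ^ (k + 2) + b ^ (k + 2) + c ^ (k + 2))
    - (a * b + b * c + c * a) * (a ^ (k + 1) + b ^ (k + 1) + c ^ (k + 1))
    + (a ^ k + b ^ k + c ^ k)"
proof -
  have "a ^ k + b ^ k + c ^ k = a * b * c * (a ^ k + b ^ k + c ^ k)" using assms by simp
  then show ?thesis by (simp add: algebra_simps power_add power2_eq_square power3_eq_cube)
qed

lemma triple_sum_recurrences:
  shows triple_sum_double:
    "triple_sum (2 * \<sigma>) (2 * \<tau>) = (triple_sum \<sigma> \<tau>)\<^sup>2 - 2 * triple_sum (- \<sigma>) (- \<tau>)"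
  and triple_sum_recurrence:
    "triple_sum (of_nat (k + 3) * \<sigma>) (of_nat (k + 3) * \<tau>) =
      triple_sum \<sigma> \<tau> * triple_sum (of_nat (k + 2) * \<sigma>) (of_nat (k + 2) * \<tau>)
      - triple_sum (- \<sigma>) (- \<tau>) * triple_sum (of_nat (k + 1) * \<sigma>) (of_nat (k + 1) * \<tau>)
      + triple_sum (of_nat k * \<sigma>) (of_nat k * \<tau>)"
proof -
  define a b c where "a = ex \<sigma>" and "b = ex \<tau>" and "c = ex (- (\<sigma> + \<tau>))"
  have abc: "a * b * c = 1" unfolding a_def b_def c_def by (simp add: ex_hom)
  \<comment> \<open>The values at multiples of (\<sigma>, \<tau>) are the power sums of one fixed
    triple.\<close>
  have pow: "triple_sum (of_nat m * \<sigma>) (of_nat m * \<tau>) = a ^ m + b ^ m + c ^ m" for m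
    unfolding triple_sum_def a_def b_def c_def
    by (simp add: ex_of_nat_mult[symmetric] algebra_simps)
  have t1: "triple_sum \<sigma> \<tau> = a + b + c" using pow[of 1] by simp
  have t2: "triple_sum (- \<sigma>) (- \<tau>) = a * b + b * c + c * a"
    unfolding triple_sum_def a_def b_def c_def by (simp add: ex_hom field_simps)
  show "triple_sum (2 * \<sigma>) (2 * \<tau>) = (triple_sum \<sigma> \<tau>)\<^sup>2 - 2 * triple_sum (- \<sigma>) (- \<tau>)"
    using pow[of 2] unfolding t1 t2 by (simp add: power2_eq_square algebra_simps)
  show "triple_sum (of_nat (k + 3) * \<sigma>) (of_nat (k + 3) * \<tau>) =
      triple_sum \<sigma> \<tau> * triple_sum (of_nat (k + 2) * \<sigma>) (of_nat (k + 2) * \<tau>)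
      - triple_sum (- \<sigma>) (- \<tau>) * triple_sum (of_nat (k + 1) * \<sigma>) (of_nat (k + 1) * \<tau>)
      + triple_sum (of_nat k * \<sigma>) (of_nat k * \<tau>)"
    unfolding t1 t2 pow by (rule power_sum_recurrence[OF abc])
qed

text \<open>
  Over \<open>s = e\<^sub>1 + e\<^sub>2\<close> and \<open>m = e\<^sub>1 * e\<^sub>2\<close>, the integer polynomials in \<open>e\<^sub>1, e\<^sub>2\<close> form a free module with
  basis \<open>1, e\<^sub>1\<close>, and exchanging \<open>e\<^sub>1\<close> and \<open>e\<^sub>2\<close> keeps the coordinates. The coordinates are taken as functions
  of \<open>(s, m - 3)\<close>, which is the value of \<open>Phi_G2\<close>.
\<close>
lemma triple_sum_int_poly:
  "\<exists>U V. int_poly_fun2 U \<and> int_poly_fun2 V \<and>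
    (\<forall>\<sigma> \<tau>. triple_sum (of_nat k * \<sigma>) (of_nat k * \<tau>) =
      U (Phi_G2 (\<sigma>, \<tau>)) + triple_sum \<sigma> \<tau> * V (Phi_G2 (\<sigma>, \<tau>)))"
    (is "\<exists>U V. ?P k U V")
proof (induction k rule: less_induct)
  case (less k)
  \<comment> \<open>The recurrence has order three, so three initial cases are required.\<close>
  have "k = 0 \<or> k = 1 \<or> k = 2 \<or> k = (k - 3) + 3" by arith
  then consider "k = 0" | "k = 1" | "k = 2" | l where "k = l + 3" by metis
  then show ?case
  proof cases
    case 1
    have "?P k (\<lambda>_. 3) (\<lambda>_. 0)"
      unfolding 1 by (intro conjI int_poly_fun2_intros) (simp add: triple_sum_def ex_def)
    then show ?thesis by blast
  next
    case 2
    have "?P k (\<lambda>_. 0) (\<lambda>_. 1)"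
      unfolding 2 by (intro conjI int_poly_fun2_intros) simp
    then show ?thesis by blast
  next
    case 3
    \<comment> \<open>From \<open>e\<^sub>1^2 = s * e\<^sub>1 - m\<close> and
      \<open>e\<^sub>2 = s - e\<^sub>1\<close>, the value \<open>e\<^sub>1^2 - 2 * e\<^sub>2\<close>
      becomes \<open>(- m - 2 * s) + (s + 2) * e\<^sub>1\<close>. It is spelled with the constants
      0, 1 and 3 that \<open>int_poly_fun2_intros\<close> covers directly.\<close>
    have "?P k (\<lambda>p. 0 - (snd p + 3) - (fst p + fst p)) (\<lambda>p. fst p + 1 + 1)"
      unfolding 3
      by (intro conjI int_poly_fun2_intros)
         (simp only: of_nat_numeral triple_sum_double Phi_G2_eq fst_conv snd_conv,
          simp add: power2_eq_square algebra_simps)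
    then show ?thesis by blast
  next
    case 4
    obtain U0 V0 where 0: "?P l U0 V0" using less[of l] 4 by auto
    obtain U1 V1 where 1: "?P (l + 1) U1 V1" using less[of "l + 1"] 4 by auto
    obtain U2 V2 where 2: "?P (l + 2) U2 V2" using less[of "l + 2"] 4 by auto
    \<comment> \<open>The recurrence in coordinates, reduced by
      \<open>e\<^sub>1^2 = s * e\<^sub>1 - m\<close>, \<open>e\<^sub>2 = s - e\<^sub>1\<close> and
      \<open>e\<^sub>1 * e\<^sub>2 = m\<close>.\<close>
    have "?P k (\<lambda>p. U0 p - (snd p + 3) * V2 p - (fst p * U1 p + (snd p + 3) * V1 p))
        (\<lambda>p. U2 p + fst p * V2 p + U1 p + V0 p)"
    proof (intro conjI allI)
      fix \<sigma> \<tau>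
      let ?p = "Phi_G2 (\<sigma>, \<tau>)"
      define x where "x = triple_sum \<sigma> \<tau>"
      define y where "y = triple_sum (- \<sigma>) (- \<tau>)"
      have p: "fst ?p = x + y" "snd ?p = x * y - 3" by (simp_all add: Phi_G2_eq x_def y_def)
      have eqs: "triple_sum (of_nat l * \<sigma>) (of_nat l * \<tau>) = U0 ?p + x * V0 ?p"
        "triple_sum (of_nat (l + 1) * \<sigma>) (of_nat (l + 1) * \<tau>) = U1 ?p + x * V1 ?p"
        "triple_sum (of_nat (l + 2) * \<sigma>) (of_nat (l + 2) * \<tau>) = U2 ?p + x * V2 ?p"
        using 0 1 2 unfolding x_def by blast+
      show "triple_sum (of_nat k * \<sigma>) (of_nat k * \<tau>) =
          U0 ?p - (snd ?p + 3) * V2 ?p - (fst ?p * U1 ?p + (snd ?p + 3) * V1 ?p)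
          + triple_sum \<sigma> \<tau> * (U2 ?p + fst ?p * V2 ?p + U1 ?p + V0 ?p)"
        unfolding 4 triple_sum_recurrence eqs unfolding p x_def[symmetric] y_def[symmetric]
        by (simp add: algebra_simps)
    qed (intro int_poly_fun2_intros; use 0 1 2 in blast)+
    then show ?thesis by blast
  qed
qed

lemma G2_map_exists:
  "\<exists>G. int_poly_map2 G \<and> (\<forall>\<sigma> \<tau>. Phi_G2 (of_nat k * \<sigma>, of_nat k * \<tau>) = G (Phi_G2 (\<sigma>, \<tau>)))"
proof -
  obtain U V where UV: "int_poly_fun2 U" "int_poly_fun2 V"
    and eq: "\<And>\<sigma> \<tau>. triple_sum (of_nat k * \<sigma>) (of_nat k * \<tau>) =
      U (Phi_G2 (\<sigma>, \<tau>)) + triple_sum \<sigma> \<tau> * V (Phi_G2 (\<sigma>, \<tau>))"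
    using triple_sum_int_poly[of k] by blast
  have Phi_minus: "Phi_G2 (- \<sigma>, - \<tau>) = Phi_G2 (\<sigma>, \<tau>)" for \<sigma> \<tau>
    by (simp add: Phi_G2_eq algebra_simps)
  \<comment> \<open>\<open>Phi_G2\<close> is even, so \<open>U\<close> and \<open>V\<close> serve
    both signs: the two triple sums at the multiple are \<open>U + x * V\<close> and
    \<open>U + y * V\<close>. \<open>G\<close> records their sum, and their product minus 3, in
    terms of \<open>x + y\<close> and \<open>x * y\<close>.\<close>
  define G where "G = (\<lambda>p. (U p + U p + fst p * V p,
    U p * U p + fst p * U p * V p + (snd p + 3) * V p * V p - 3))"
  have "int_poly_map2 G"
    unfolding int_poly_map2_def G_def fst_conv snd_conv by (intro conjI int_poly_fun2_intros UV)
  moreover have "Phi_G2 (of_nat k * \<sigma>, of_nat k * \<tau>) = G (Phi_G2 (\<sigma>, \<tau>))" for \<sigma> \<tau>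
  proof -
    let ?p = "Phi_G2 (\<sigma>, \<tau>)"
    define x where "x = triple_sum \<sigma> \<tau>"
    define y where "y = triple_sum (- \<sigma>) (- \<tau>)"
    have p: "fst ?p = x + y" "snd ?p = x * y - 3" by (simp_all add: Phi_G2_eq x_def y_def)
    have "Phi_G2 (of_nat k * \<sigma>, of_nat k * \<tau>) =
      ((U ?p + x * V ?p) + (U ?p + y * V ?p), (U ?p + x * V ?p) * (U ?p + y * V ?p) - 3)"
      using eq[of \<sigma> \<tau>] eq[of "- \<sigma>" "- \<tau>"]
      by (simp add: Phi_G2_eq[of "of_nat k * \<sigma>"] x_def y_def Phi_minus)
    also have "\<dots> = G ?p"
      unfolding G_def p by (simp add: algebra_simps)
    finally show ?thesis .
  qed
  ultimately show ?thesis by blast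
qed

text \<open>Resolves the definite description: two candidates agree on the range of
  \<open>Phi_G2\<close>, which is everything. Later arguments use \<open>G2_map\<close> only through
  this equation.\<close>

lemma G2_map_Phi_G2: "G2_map k (Phi_G2 (\<sigma>, \<tau>)) = Phi_G2 (of_nat k * \<sigma>, of_nat k * \<tau>)"
proof -
  let ?Q = "\<lambda>G. int_poly_map2 G \<and>
    (\<forall>\<sigma> \<tau>. Phi_G2 (of_nat k * \<sigma>, of_nat k * \<tau>) = G (Phi_G2 (\<sigma>, \<tau>)))"
  have "\<exists>!G. ?Q G"
  proof (rule ex_ex1I[OF G2_map_exists])
    fix G H assume "?Q G" "?Q H"
    then have "G (Phi_G2 z) = H (Phi_G2 z)" for z by (cases z) metis
    then show "G = H" using surj_Phi_G2 by (metis surjD ext)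
  qed
  then have "?Q (G2_map k)" unfolding G2_map_def by (rule theI')
  then show ?thesis by simp
qed

section \<open>Points with equal image\<close>

text \<open>\<open>a'\<close> is a root of \<open>(X - a) * (X - b) * (X - c)\<close>. Once it is
  matched, the other two entries have the same sum and product as the two remaining roots.\<close>

lemma elementary_symmetric_eq_imp:
  fixes a b c :: "'a :: idom"
  assumes "a' + b' + c' = a + b + c" "a' * b' + b' * c' + c' * a' = a * b + b * c + c * a"
    "a' * b' * c' = a * b * c"
  shows "a' = a \<and> b' = b \<and> c' = c \<or> a' = a \<and> b' = c \<and> c' = b \<or> a' = b \<and> b' = a \<and> c' = c
    \<or> a' = b \<and> b' = c \<and> c' = a \<or> a' = c \<and> b' = a \<and> c' = b \<or> a' = c \<and> b' = b \<and> c' = a"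
proof -
  have pair: "b' = q \<and> c' = r \<or> b' = r \<and> c' = q"
    if "a' = p" "p + q + r = a + b + c" "p * q + q * r + r * p = a * b + b * c + c * a" for p q r
  proof (rule iffD1[OF sum_prod_eq_iff], rule conjI)
    show s: "b' + c' = q + r" using assms(1) unfolding that(2)[symmetric] that(1) by (simp add: add.assoc)
    have "b' * c' = (a' * b' + b' * c' + c' * a') - a' * (b' + c')" by (simp add: algebra_simps)
    also have "\<dots> = (a * b + b * c + c * a) - a' * (b' + c')" unfolding assms(2) ..
    also have "\<dots> = q * r" unfolding s that(1) that(3)[symmetric] by (simp add: algebra_simps)
    finally show "b' * c' = q * r" .
  qed
  have "(a' - a) * (a' - b) * (a' - c)
      = a' * a' * a' - (a + b + c) * (a' * a') + (a * b + b * c + c * a) * a' - a * b * c"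
    by (simp add: algebra_simps)
  also have "\<dots> = 0" unfolding assms[symmetric] by (simp add: algebra_simps)
  finally consider "a' = a" | "a' = b" | "a' = c" by auto
  then show ?thesis
  proof cases
    case 1 then show ?thesis using pair[of a b c] by auto
  next
    case 2 then show ?thesis using pair[of b c a] by (auto simp: algebra_simps)
  next
    case 3 then show ?thesis using pair[of c a b] by (auto simp: algebra_simps)
  qed
qed

text \<open>The hypotheses equate \<open>e\<^sub>1\<close> and \<open>e\<^sub>2\<close>; the third
  symmetric function is 1 for both triples.\<close>

lemma triple_sum_eq_imp:
  assumes "triple_sum \<sigma>' \<tau>' = triple_sum \<sigma> \<tau>" "triple_sum (- \<sigma>') (- \<tau>') = triple_sum (- \<sigma>) (- \<tau>)"
  defines "\<rho> \<equiv> - (\<sigma> + \<tau>)"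
  shows "ex \<sigma>' = ex \<sigma> \<and> ex \<tau>' = ex \<tau> \<or> ex \<sigma>' = ex \<sigma> \<and> ex \<tau>' = ex \<rho>
    \<or> ex \<sigma>' = ex \<tau> \<and> ex \<tau>' = ex \<sigma> \<or> ex \<sigma>' = ex \<tau> \<and> ex \<tau>' = ex \<rho>
    \<or> ex \<sigma>' = ex \<rho> \<and> ex \<tau>' = ex \<sigma> \<or> ex \<sigma>' = ex \<rho> \<and> ex \<tau>' = ex \<tau>"
proof -
  have e2: "triple_sum (- \<sigma>) (- \<tau>) =
      ex \<sigma> * ex \<tau> + ex \<tau> * ex (- (\<sigma> + \<tau>)) + ex (- (\<sigma> + \<tau>)) * ex \<sigma>" for \<sigma> \<tau>
    unfolding triple_sum_def by (simp add: ex_hom field_simps)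
  have e3: "ex \<sigma> * ex \<tau> * ex (- (\<sigma> + \<tau>)) = 1" for \<sigma> \<tau>
    by (simp add: ex_hom)
  show ?thesis
    using elementary_symmetric_eq_imp[of "ex \<sigma>'" "ex \<tau>'" "ex (- (\<sigma>' + \<tau>'))" "ex \<sigma>" "ex \<tau>" "ex \<rho>"]
      assms(1,2)
    unfolding e2 e3 \<rho>_def unfolding triple_sum_def by blast
qed

lemma triple_sum_cong:
  assumes "ex \<sigma>' = ex \<sigma>" "ex \<tau>' = ex \<tau>"
  shows "triple_sum \<sigma>' \<tau>' = triple_sum \<sigma> \<tau>" "triple_sum (- \<sigma>') (- \<tau>') = triple_sum (- \<sigma>) (- \<tau>)"
    "Phi_G2 (\<sigma>', \<tau>') = Phi_G2 (\<sigma>, \<tau>)"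
  using assms by (simp_all add: triple_sum_def ex_hom Phi_G2_eq)

text \<open>These two transpositions generate all permutations of \<sigma>, \<tau>,
  \<open>- (\<sigma> + \<tau>)\<close>.\<close>

lemma Phi_G2_perm:
  "Phi_G2 (\<tau>, \<sigma>) = Phi_G2 (\<sigma>, \<tau>)" "Phi_G2 (\<sigma>, - (\<sigma> + \<tau>)) = Phi_G2 (\<sigma>, \<tau>)"
  by (simp_all add: Phi_G2_eq triple_sum_def add_ac)

lemma Phi_G2_eq_iff:
  "Phi_G2 (\<sigma>', \<tau>') = Phi_G2 (\<sigma>, \<tau>) \<longleftrightarrow>
    triple_sum \<sigma>' \<tau>' = triple_sum \<sigma> \<tau> \<and> triple_sum (- \<sigma>') (- \<tau>') = triple_sum (- \<sigma>) (- \<tau>) \<or>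
    triple_sum (- \<sigma>') (- \<tau>') = triple_sum \<sigma> \<tau> \<and> triple_sum \<sigma>' \<tau>' = triple_sum (- \<sigma>) (- \<tau>)"
  using sum_prod_eq_iff[of "triple_sum \<sigma>' \<tau>'" "triple_sum (- \<sigma>') (- \<tau>')"
      "triple_sum \<sigma> \<tau>" "triple_sum (- \<sigma>) (- \<tau>)"]
  by (auto simp: Phi_G2_eq)

section \<open>Points permuted by a multiplication\<close>

text \<open>By \<open>triple_sum_eq_imp\<close>, the two equations say that multiplication by
  \<open>L\<close> permutes the triple modulo the integers. A complex \<open>L\<close> allows both
  \<open>k\<close> and \<open>- k\<close>.\<close>

definition permuted_images :: "complex \<Rightarrow> (complex \<times> complex) set" where
  "permuted_images L = {Phi_G2 (\<sigma>, \<tau>) | \<sigma> \<tau>. triple_sum (L * \<sigma>) (L * \<tau>) = triple_sum \<sigma> \<tau> \<and>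
    triple_sum (- (L * \<sigma>)) (- (L * \<tau>)) = triple_sum (- \<sigma>) (- \<tau>)}"

text \<open>Surjectivity lifts each fixed point to some (\<sigma>, \<tau>). The inverted alternative
  of \<open>Phi_G2_eq_iff\<close> for \<open>k\<close> is the direct one for
  \<open>- k\<close>.\<close>

lemma Fix_G2_map: "Fix (G2_map k) = permuted_images (of_nat k) \<union> permuted_images (- of_nat k)"
proof -
  have "Fix (G2_map k) = {Phi_G2 (\<sigma>, \<tau>) | \<sigma> \<tau>.
      Phi_G2 (of_nat k * \<sigma>, of_nat k * \<tau>) = Phi_G2 (\<sigma>, \<tau>)}"
  proof (intro equalityI subsetI)
    fix \<alpha> assume \<alpha>: "\<alpha> \<in> Fix (G2_map k)"
    obtain \<sigma> \<tau> where "\<alpha> = Phi_G2 (\<sigma>, \<tau>)" using surjD[OF surj_Phi_G2, of \<alpha>] by auto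
    with \<alpha> show "\<alpha> \<in> {Phi_G2 (\<sigma>, \<tau>) | \<sigma> \<tau>.
        Phi_G2 (of_nat k * \<sigma>, of_nat k * \<tau>) = Phi_G2 (\<sigma>, \<tau>)}"
      by (auto simp: Fix_def G2_map_Phi_G2)
  qed (auto simp: Fix_def G2_map_Phi_G2)
  also have "\<dots> = permuted_images (of_nat k) \<union> permuted_images (- of_nat k)"
    unfolding permuted_images_def Phi_G2_eq_iff mult_minus_left minus_minus by blast
  finally show ?thesis .
qed

section \<open>Solving the congruences for an integer multiplier\<close>

context
  fixes L :: complex and l :: int
  assumes L: "L = of_int l" and nz: "L - 1 \<noteq> 0" "L\<^sup>2 - 1 \<noteq> 0" "L\<^sup>2 + L + 1 \<noteq> 0"
begin

lemma image_of_fixed_pair: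
  assumes "ex (L * \<sigma>) = ex \<sigma>" "ex (L * \<tau>) = ex \<tau>"
  shows "\<exists>d e. Phi_G2 (\<sigma>, \<tau>) = Phi_G2 (of_int d / (L - 1), of_int e / (L - 1))"
proof -
  obtain d e where "L * \<sigma> = \<sigma> + of_int d" "L * \<tau> = \<tau> + of_int e"
    using assms unfolding ex_eq_iff by blast
  then have "\<sigma> = of_int d / (L - 1)" "\<tau> = of_int e / (L - 1)"
    using nz by (simp_all add: field_simps)
  then show ?thesis by blast
qed

lemma image_of_swapped_pair:
  assumes "ex (L * \<sigma>) = ex \<tau>" "ex (L * \<tau>) = ex \<sigma>"
  shows "\<exists>d. Phi_G2 (\<sigma>, \<tau>) = Phi_G2 (of_int d / (L\<^sup>2 - 1), of_int d * L / (L\<^sup>2 - 1))"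
proof -
  obtain m n where mn: "L * \<sigma> = \<tau> + of_int m" "L * \<tau> = \<sigma> + of_int n"
    using assms unfolding ex_eq_iff by blast
  \<comment> \<open>Applying \<open>L\<close> twice returns \<sigma> modulo the integers;
    eliminating \<tau> gives the numerator \<open>l * m + n\<close>.\<close>
  have "(L\<^sup>2 - 1) * \<sigma> = L * (\<tau> + of_int m) - \<sigma>"
    unfolding mn(1)[symmetric] by (simp add: algebra_simps power2_eq_square)
  also have "\<dots> = of_int (l * m + n)" using mn(2) by (simp add: L algebra_simps)
  finally have \<sigma>: "\<sigma> = of_int (l * m + n) / (L\<^sup>2 - 1)" using nz by (simp add: field_simps)
  \<comment> \<open>\<tau> equals \<open>L * \<sigma>\<close> only up to an integer, which neither
    \<open>ex\<close> nor \<open>Phi_G2\<close> detects.\<close>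
  have "ex \<tau> = ex (of_int (l * m + n) * L / (L\<^sup>2 - 1))"
    using assms(1) unfolding \<sigma> by (simp add: mult.commute)
  then show ?thesis using triple_sum_cong(3)[of \<sigma> _ \<tau>] \<sigma> by metis
qed

lemma image_of_cycled_pair:
  assumes "ex (L * \<sigma>) = ex \<tau>" "ex (L * \<tau>) = ex (- (\<sigma> + \<tau>))"
  shows "\<exists>d. Phi_G2 (\<sigma>, \<tau>) = Phi_G2 (of_int d / (L\<^sup>2 + L + 1), of_int d * L / (L\<^sup>2 + L + 1))"
proof -
  obtain m n where mn: "L * \<sigma> = \<tau> + of_int m" "L * \<tau> = - (\<sigma> + \<tau>) + of_int n"
    using assms unfolding ex_eq_iff by blast
  \<comment> \<open>Adding up the orbit \<sigma>, \<open>L * \<sigma>\<close>,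
    \<open>L\<^sup>2 * \<sigma>\<close>: modulo the integers it is the triple, whose sum is
    0.\<close>
  have "(L\<^sup>2 + L + 1) * \<sigma> = L * (\<tau> + of_int m) + (\<tau> + of_int m) + \<sigma>"
    unfolding mn(1)[symmetric] by (simp add: algebra_simps power2_eq_square)
  also have "\<dots> = of_int (l * m + m + n)" using mn(2) by (simp add: L algebra_simps)
  finally have \<sigma>: "\<sigma> = of_int (l * m + m + n) / (L\<^sup>2 + L + 1)" using nz by (simp add: field_simps)
  have "ex \<tau> = ex (of_int (l * m + m + n) * L / (L\<^sup>2 + L + 1))"
    using assms(1) unfolding \<sigma> by (simp add: mult.commute)
  then show ?thesis using triple_sum_cong(3)[of \<sigma> _ \<tau>] \<sigma> by metis
qed

lemma permuted_images_eq:
  "permuted_images L =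
      {Phi_G2 (of_int d / (L - 1), of_int e / (L - 1)) | d e. True}
    \<union> {Phi_G2 (of_int d / (L\<^sup>2 - 1), of_int d * L / (L\<^sup>2 - 1)) | d. True}
    \<union> {Phi_G2 (of_int d / (L\<^sup>2 + L + 1), of_int d * L / (L\<^sup>2 + L + 1)) | d. True}"
    (is "_ = ?A \<union> ?B \<union> ?C")
proof (intro equalityI subsetI)
  fix \<alpha> assume "\<alpha> \<in> permuted_images L"
  then obtain \<sigma> \<tau> where \<alpha>: "\<alpha> = Phi_G2 (\<sigma>, \<tau>)"
    and eq: "triple_sum (L * \<sigma>) (L * \<tau>) = triple_sum \<sigma> \<tau>"
      "triple_sum (- (L * \<sigma>)) (- (L * \<tau>)) = triple_sum (- \<sigma>) (- \<tau>)"
    unfolding permuted_images_def by blast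
  define \<rho> where "\<rho> = - (\<sigma> + \<tau>)"
  have L\<rho>: "ex (L * \<rho>) = inverse (ex (L * \<sigma>) * ex (L * \<tau>))"
    by (simp add: \<rho>_def ex_hom algebra_simps divide_inverse)
  have ex\<rho>: "ex \<rho> = inverse (ex \<sigma> * ex \<tau>)"
    by (simp add: \<rho>_def ex_hom field_simps)
  from triple_sum_eq_imp[OF eq, folded \<rho>_def]
  consider "ex (L * \<sigma>) = ex \<sigma>" "ex (L * \<tau>) = ex \<tau>"
    | "ex (L * \<sigma>) = ex \<sigma>" "ex (L * \<tau>) = ex \<rho>"
    | "ex (L * \<sigma>) = ex \<tau>" "ex (L * \<tau>) = ex \<sigma>"
    | "ex (L * \<sigma>) = ex \<tau>" "ex (L * \<tau>) = ex \<rho>"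
    | "ex (L * \<sigma>) = ex \<rho>" "ex (L * \<tau>) = ex \<sigma>"
    | "ex (L * \<sigma>) = ex \<rho>" "ex (L * \<tau>) = ex \<tau>" by blast
  then show "\<alpha> \<in> ?A \<union> ?B \<union> ?C"
  proof cases
    case 1
    then show ?thesis using image_of_fixed_pair \<alpha> by blast
  next
    case 2
    \<comment> \<open>\<sigma> is fixed while \<tau> and \<rho> are exchanged, so (\<tau>, \<rho>)
      is a swapped pair with the same image.\<close>
    then have "ex (L * \<rho>) = ex \<tau>" by (simp add: L\<rho> ex\<rho>)
    moreover have "\<alpha> = Phi_G2 (\<tau>, \<rho>)"
      using \<alpha> Phi_G2_perm(1)[of \<tau> \<sigma>] Phi_G2_perm(2)[of \<tau> \<sigma>] by (simp add: \<rho>_def add.commute)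
    ultimately show ?thesis using image_of_swapped_pair 2(2) by blast
  next
    case 3
    then show ?thesis using image_of_swapped_pair \<alpha> by blast
  next
    case 4
    then show ?thesis using image_of_cycled_pair \<alpha> unfolding \<rho>_def by blast
  next
    case 5
    \<comment> \<open>The inverse cycle runs from \<tau> to \<sigma> to \<rho>, hence the pair is
      read as (\<tau>, \<sigma>).\<close>
    then have "ex (L * \<sigma>) = ex (- (\<tau> + \<sigma>))" unfolding \<rho>_def by (simp only: add.commute)
    moreover have "\<alpha> = Phi_G2 (\<tau>, \<sigma>)" using \<alpha> Phi_G2_perm(1) by metis
    ultimately show ?thesis using image_of_cycled_pair 5(2) by blast
  next
    case 6
    \<comment> \<open>Here \<tau> is fixed and (\<sigma>, \<rho>) is the swapped pair.\<close>
    then have "ex (L * \<rho>) = ex \<sigma>" by (simp add: L\<rho> ex\<rho>)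
    moreover have "\<alpha> = Phi_G2 (\<sigma>, \<rho>)" using \<alpha> Phi_G2_perm(2) \<rho>_def by metis
    ultimately show ?thesis using image_of_swapped_pair 6(1) by blast
  qed
next
  fix \<alpha> assume "\<alpha> \<in> ?A \<union> ?B \<union> ?C"
  then consider d e where "\<alpha> = Phi_G2 (of_int d / (L - 1), of_int e / (L - 1))"
    | d where "\<alpha> = Phi_G2 (of_int d / (L\<^sup>2 - 1), of_int d * L / (L\<^sup>2 - 1))"
    | d where "\<alpha> = Phi_G2 (of_int d / (L\<^sup>2 + L + 1), of_int d * L / (L\<^sup>2 + L + 1))"
    by blast
  then show "\<alpha> \<in> permuted_images L"
  proof cases
    case 1
    define \<sigma> \<tau> where "\<sigma> = of_int d / (L - 1)" and "\<tau> = of_int e / (L - 1)"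
    have "L * \<sigma> = \<sigma> + of_int d" "L * \<tau> = \<tau> + of_int e"
      using nz by (simp_all add: \<sigma>_def \<tau>_def field_simps)
    then have "ex (L * \<sigma>) = ex \<sigma>" "ex (L * \<tau>) = ex \<tau>" unfolding ex_eq_iff by blast+
    from triple_sum_cong(1,2)[OF this] show ?thesis
      using 1 unfolding permuted_images_def \<sigma>_def \<tau>_def by blast
  next
    case 2
    define \<sigma> \<tau> where "\<sigma> = of_int d / (L\<^sup>2 - 1)" and "\<tau> = of_int d * L / (L\<^sup>2 - 1)"
    have L\<sigma>: "L * \<sigma> = \<tau>" by (simp add: \<sigma>_def \<tau>_def)
    have "L * \<tau> = \<sigma> + of_int d"
      using nz by (simp add: \<sigma>_def \<tau>_def field_simps power2_eq_square)
    then have "ex (L * \<tau>) = ex \<sigma>" unfolding ex_eq_iff by blast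
    from triple_sum_cong(1,2)[OF _ this, of \<tau> \<tau>]
    have "triple_sum (L * \<sigma>) (L * \<tau>) = triple_sum \<sigma> \<tau>"
      "triple_sum (- (L * \<sigma>)) (- (L * \<tau>)) = triple_sum (- \<sigma>) (- \<tau>)"
      unfolding L\<sigma> by (simp_all add: triple_sum_def add_ac)
    then show ?thesis
      using 2 unfolding permuted_images_def \<sigma>_def \<tau>_def by blast
  next
    case 3
    define \<sigma> \<tau> where "\<sigma> = of_int d / (L\<^sup>2 + L + 1)" and "\<tau> = of_int d * L / (L\<^sup>2 + L + 1)"
    have L\<sigma>: "L * \<sigma> = \<tau>" by (simp add: \<sigma>_def \<tau>_def)
    have "(L\<^sup>2 + L + 1) * \<sigma> = of_int d" using nz by (simp add: \<sigma>_def)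
    then have "L * \<tau> = - (\<sigma> + \<tau>) + of_int d"
      unfolding L\<sigma>[symmetric] by (simp add: algebra_simps power2_eq_square)
    then have "ex (L * \<tau>) = ex (- (\<sigma> + \<tau>))" unfolding ex_eq_iff by blast
    \<comment> \<open>\<open>L\<close> sends the pair to (\<tau>,
      \<open>- (\<sigma> + \<tau>)\<close>), whose completing third member is \<sigma>.\<close>
    from triple_sum_cong(1,2)[OF _ this, of \<tau> \<tau>]
    have "triple_sum (L * \<sigma>) (L * \<tau>) = triple_sum \<sigma> \<tau>"
      "triple_sum (- (L * \<sigma>)) (- (L * \<tau>)) = triple_sum (- \<sigma>) (- \<tau>)"
      unfolding L\<sigma> by (simp_all add: triple_sum_def add_ac)
    then show ?thesis
      using 3 unfolding permuted_images_def \<sigma>_def \<tau>_def by blast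
  qed
qed

end

section \<open>Combining the multipliers \<open>k\<close> and \<open>- k\<close>\<close>

theorem theorem3p3:
  fixes k :: nat
  assumes "k \<ge> 2"
  defines "K \<equiv> (of_nat k :: complex)"
  shows "Fix (G2_map k) =
      {Phi_G2 (of_int d / (K - 1), of_int e / (K - 1)) | d e. True}
    \<union> {Phi_G2 (of_int d / (K^2 - 1), of_int d * K / (K^2 - 1)) | d. True}
    \<union> {Phi_G2 (of_int d / (K^2 + K + 1), of_int d * K / (K^2 + K + 1)) | d. True}
    \<union> {Phi_G2 (of_int d / (K + 1), of_int e / (K + 1)) | d e. True}
    \<union> {Phi_G2 (of_int d / (K^2 - 1), - of_int d * K / (K^2 - 1)) | d. True}
    \<union> {Phi_G2 (of_int d / (K^2 - K + 1), - of_int d * K / (K^2 - K + 1)) | d. True}"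
proof -
  have K: "K = of_int (int k)" by (simp add: K_def)
  have k: "int k \<ge> 2" using assms(1) by simp
  \<comment> \<open>With this bound, linear arithmetic shows that the quadratic denominators do not
    vanish.\<close>
  have sq: "int k * int k \<ge> 2 * int k" using k by (intro mult_right_mono) auto
  have nz: "K - 1 \<noteq> 0" "K + 1 \<noteq> 0" "K\<^sup>2 - 1 \<noteq> 0" "K\<^sup>2 + K + 1 \<noteq> 0" "K\<^sup>2 - K + 1 \<noteq> 0"
  proof -
    have "of_int (int k - 1) \<noteq> (0 :: complex)" "of_int (int k + 1) \<noteq> (0 :: complex)"
      "of_int (int k * int k - 1) \<noteq> (0 :: complex)"
      "of_int (int k * int k + int k + 1) \<noteq> (0 :: complex)"
      "of_int (int k * int k - int k + 1) \<noteq> (0 :: complex)"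
      unfolding of_int_eq_0_iff using k sq by linarith+
    then show "K - 1 \<noteq> 0" "K + 1 \<noteq> 0" "K\<^sup>2 - 1 \<noteq> 0" "K\<^sup>2 + K + 1 \<noteq> 0" "K\<^sup>2 - K + 1 \<noteq> 0"
      unfolding K power2_eq_square by simp_all
  qed
  \<comment> \<open>For the multiplier \<open>- K\<close> the first denominator is
    \<open>- (K + 1)\<close>; its sign is absorbed by replacing \<open>d\<close> with
    \<open>- d\<close>.\<close>
  have neg: "of_int d / (- K - 1) = of_int (- d) / (K + 1)" for d
  proof -
    have "- K - 1 = - (K + 1)" by simp
    then show ?thesis by (simp only: of_int_minus divide_minus_left divide_minus_right)
  qed
  have "{Phi_G2 (of_int d / (- K - 1), of_int e / (- K - 1)) | d e. True} =
      {Phi_G2 (of_int d / (K + 1), of_int e / (K + 1)) | d e. True}"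
    (is "?S = ?T")
  proof (intro equalityI subsetI)
    fix \<alpha> assume "\<alpha> \<in> ?S"
    then show "\<alpha> \<in> ?T" unfolding neg by blast
  next
    fix \<alpha> assume "\<alpha> \<in> ?T"
    then obtain d e where "\<alpha> = Phi_G2 (of_int d / (K + 1), of_int e / (K + 1))" by blast
    then have "\<alpha> = Phi_G2 (of_int (- d) / (- K - 1), of_int (- e) / (- K - 1))"
      unfolding neg minus_minus .
    then show "\<alpha> \<in> ?S" by blast
  qed
  moreover have "permuted_images (- K) =
      {Phi_G2 (of_int d / (- K - 1), of_int e / (- K - 1)) | d e. True}
    \<union> {Phi_G2 (of_int d / (K\<^sup>2 - 1), - of_int d * K / (K\<^sup>2 - 1)) | d. True}
    \<union> {Phi_G2 (of_int d / (K\<^sup>2 - K + 1), - of_int d * K / (K\<^sup>2 - K + 1)) | d. True}"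
  proof -
    \<comment> \<open>In the other two families squaring removes the sign or it turns
      \<open>+ K\<close> into \<open>- K\<close>; the numerator of the second coordinate keeps
      it.\<close>
    have sq: "(- K)\<^sup>2 = K\<^sup>2" "K\<^sup>2 + - K = K\<^sup>2 - K" and mult: "of_int d * - K = - of_int d * K" for d
      by simp_all
    have "- K - 1 = - (K + 1)" by simp
    then have "- K - 1 \<noteq> 0" using nz(2) by (simp only: neg_equal_0_iff_equal not_False_eq_True)
    moreover have "- K = of_int (- int k)" by (simp add: K)
    ultimately show ?thesis
      using permuted_images_eq[of "- K" "- int k", unfolded sq mult] nz(3,5) by blast
  qed
  ultimately have "permuted_images (- K) =
      {Phi_G2 (of_int d / (K + 1), of_int e / (K + 1)) | d e. True}
    \<union> {Phi_G2 (of_int d / (K\<^sup>2 - 1), - of_int d * K / (K\<^sup>2 - 1)) | d. True}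
    \<union> {Phi_G2 (of_int d / (K\<^sup>2 - K + 1), - of_int d * K / (K\<^sup>2 - K + 1)) | d. True}"
    by (simp only:)
  then show ?thesis
    unfolding Fix_G2_map K_def[symmetric] permuted_images_eq[OF K nz(1,3,4)] by (simp only: Un_assoc)
qed

end
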